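(* For any $\omega$-saturated pointed models $\langle\mathcal{M},S\rangle$ and $\langle\mathcal{M}',S'\rangle$: if they are learning modal equivalent (i.e., $\mathcal{M},S\models\varphi\Leftrightarrow\mathcal{M}',S'\models\varphi$ for all $\varphi\in\mathcal{L}$), then there is an l-bisimulation $Z_l$ with $\langle\mathcal{M},S\rangle Z_l\langle\mathcal{M}',S'\rangle$.
   Context: Fix a countable set $\mathbf{P}$ of atoms. The language $\mathcal{L}$ of SLL is $\varphi::=p\mid\neg\varphi\mid(\varphi\land\varphi)\mid\Diamond_L\varphi\mid\langle-\rangle_1\varphi\mid\langle-\rangle_2\varphi\mid\langle+\rangle\varphi$, where $\Diamond_L$ is the learner-move modality (drawn as a black diamond in the paper). A model is $\mathcal{M}=\langle W,R_1,R_2,V\rangle$ with $W\neq\emptyset$, $R_1,R_2\subseteq W^2$, $V:\mathbf{P}\to2^W$. For a finite non-empty sequence $S=\langle w_0,\dots,w_n\rangle$: $e(S)=w_n$; $Set(S)=\{\langle w_i,w_{i+1}\rangle\mid i<n\}$ ($\emptyset$ if singleton); for $\langle w_i,w_{i+1}\rangle\in Set(S)$, $S|_{\langle w_i,w_{i+1}\rangle}=\langle w_0,\dots,w_u\rangle$ with $u$ least such that $\langle w_u,w_{u+1}\rangle=\langle w_i,w_{i+1}\rangle$; $S;v$ is $S$ extended by $v$. A pointed model $\langle\mathcal{M},S\rangle$ requires $Set(S)\subseteq R_1$. $\mathcal{M}\ominus\langle v,v'\rangle$ / $\mathcal{M}\oplus\langle v,v'\rangle$ remove / add $\langle v,v'\rangle$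 from / to $R_1$. Semantics: $\mathcal{M},S\models p$ iff $e(S)\in V(p)$; Booleans as usual; $\Diamond_L\varphi$ iff there is $v$ with $R_1e(S)v$ and $\mathcal{M},S;v\models\varphi$; $\langle-\rangle_1\varphi$ iff there is $\langle v,v'\rangle\in Set(S)\setminus R_2$ with $\mathcal{M}\ominus\langle v,v'\rangle,S|_{\langle v,v'\rangle}\models\varphi$; $\langle-\rangle_2\varphi$ iff there is $\langle v,v'\rangle\in(R_1\setminus R_2)\setminus Set(S)$ with $\mathcal{M}\ominus\langle v,v'\rangle,S\models\varphi$; $\langle+\rangle\varphi$ iff there is $\langle v,v'\rangle\in R_2\setminus R_1$ with $\mathcal{M}\oplus\langle v,v'\rangle,S\models\varphi$. Let $\mathbf{U}$ relate $\langle\mathcal{M},S\rangle$ to each of $\langle\mathcal{M}\ominus\langle v,v'\rangle,S|_{\langle v,v'\rangle}\rangle$ ($\langle v,v'\rangle\in Set(S)\setminus R_2$), $\langle\mathcal{M}\ominus\langle v,v'\rangle,S\rangle$ ($\langle v,v'\rangle\in(R_1\setminus R_2)\setminus Set(S)$), $\langle\mathcal{M}\oplus\langle v,v'\rangle,S\rangle$ ($\langle v,v'\rangle\in R_2\setminus R_1$); $\mathbf{U}^*$ is its reflexive-transitive closure. An l-bisimulation between $\langle\mathcal{M},S\rangle$ and $\langle\mathcal{M}',S'\rangle$ is a non-empty relation $Z_l\subseteq\mathbf{U}^*(\langle\mathcal{M},S\rangle)\times\mathbf{U}^*(\langle\mathcal{M}',S'\rangle)$ containing this pair such that every related pair $\langle\mathcal{N},T\rangle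 Z_l\langle\mathcal{N}',T'\rangle$ (relations $Q_1,Q_2$ resp. $Q'_1,Q'_2$) satisfies: (Atom) same atoms true at $T$ and $T'$; (Zig$_{\Diamond_L}$) if $Q_1e(T)v$ then there is $v'$ with $Q'_1e(T')v'$ and $\langle\mathcal{N},T;v\rangle Z_l\langle\mathcal{N}',T';v'\rangle$; (Zig$_{\langle-\rangle_1}$) if $\langle u,v\rangle\in Set(T)\setminus Q_2$ then there is $\langle u',v'\rangle\in Set(T')\setminus Q'_2$ with $\langle\mathcal{N}\ominus\langle u,v\rangle,T|_{\langle u,v\rangle}\rangle Z_l\langle\mathcal{N}'\ominus\langle u',v'\rangle,T'|_{\langle u',v'\rangle}\rangle$; (Zig$_{\langle-\rangle_2}$) if $\langle u,v\rangle\in(Q_1\setminus Q_2)\setminus Set(T)$ then there is $\langle u',v'\rangle\in(Q'_1\setminus Q'_2)\setminus Set(T')$ with $\langle\mathcal{N}\ominus\langle u,v\rangle,T\rangle Z_l\langle\mathcal{N}'\ominus\langle u',v'\rangle,T'\rangle$; (Zig$_{\langle+\rangle}$) if $\langle u,v\rangle\in Q_2\setminus Q_1$ then there is $\langle u',v'\rangle\in Q'_2\setminus Q'_1$ with $\langle\mathcal{N}\oplus\langle u,v\rangle,T\rangle Z_l\langle\mathcal{N}'\oplus\langle u',v'\rangle,T'\rangle$; plus the four converse Zag clauses. Models are viewed as structures for the first-order language $\mathcal{L}_1$ with unary predicates $P_i$ (one per atom), binary $R_1,R_2$ and equality. A model $\mathcal{M}$ is $\omega$-saturated if for every finite $Y\subseteq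 W$, the expansion $\mathcal{M}^Y$ (with constants for $Y$) realizes every set $\Gamma(\mathbf{x})$ of $\mathcal{L}_1^Y$-formulas in finitely many free variables all of whose finite subsets are realized in $\mathcal{M}^Y$; a pointed model is $\omega$-saturated if its model is.
   Formalization: As printed, Z_l is bounded by U*, which has no learner moves, so Zig for the learner diamond fails once e(S) has an R_1-successor; here the bound is the closure of U together with learner moves. The set of atoms is taken to be non-empty. *)

theory Defs
  imports Main "HOL-Library.Countable"
begin

section \<open>Syntax and semantics\<close>

text \<open>
  The type of atoms is required to be of class \<^class>\<open>countable\<close> where it matters. Types are
  inhabited, so there is at least one atom; without atoms the language would contain no formula.
\<close>

datatype 'p form =
    Atom 'p
  | Neg "'p form"
  | And "'p form" "'p form"
  | DiaL "'p form"
  | DiaMinus1 "'p form"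
  | DiaMinus2 "'p form"
  | DiaPlus "'p form"

record ('w, 'p) model =
  Worlds :: "'w set"
  Rel1 :: "('w \<times> 'w) set"
  Rel2 :: "('w \<times> 'w) set"
  Val :: "'p \<Rightarrow> 'w set"

definition is_model :: "('w, 'p) model \<Rightarrow> bool" where
  "is_model M \<longleftrightarrow> Worlds M \<noteq> {} \<and> Rel1 M \<subseteq> Worlds M \<times> Worlds M \<and>
     Rel2 M \<subseteq> Worlds M \<times> Worlds M \<and> (\<forall>p. Val M p \<subseteq> Worlds M)"

definition links :: "'w list \<Rightarrow> ('w \<times> 'w) set" where
  "links S = {(S ! i, S ! Suc i) | i. Suc i < length S}"

text \<open>Only meaningful for \<open>l \<in> links S\<close>.\<close>

definition cut :: "'w list \<Rightarrow> 'w \<times> 'w \<Rightarrow> 'w list" where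
  "cut S l = take (Suc (LEAST u. Suc u < length S \<and> (S ! u, S ! Suc u) = l)) S"

definition delete :: "('w, 'p) model \<Rightarrow> 'w \<times> 'w \<Rightarrow> ('w, 'p) model" where
  "delete M l = M\<lparr>Rel1 := Rel1 M - {l}\<rparr>"

definition add :: "('w, 'p) model \<Rightarrow> 'w \<times> 'w \<Rightarrow> ('w, 'p) model" where
  "add M l = M\<lparr>Rel1 := Rel1 M \<union> {l}\<rparr>"

definition pointed_model :: "('w, 'p) model \<Rightarrow> 'w list \<Rightarrow> bool" where
  "pointed_model M S \<longleftrightarrow>
     is_model M \<and> S \<noteq> [] \<and> set S \<subseteq> Worlds M \<and> links S \<subseteq> Rel1 M"

primrec sat :: "('w, 'p) model \<Rightarrow> 'w list \<Rightarrow> 'p form \<Rightarrow> bool" where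
  "sat M S (Atom p) \<longleftrightarrow> last S \<in> Val M p"
| "sat M S (Neg \<phi>) \<longleftrightarrow> \<not> sat M S \<phi>"
| "sat M S (And \<phi> \<psi>) \<longleftrightarrow> sat M S \<phi> \<and> sat M S \<psi>"
| "sat M S (DiaL \<phi>) \<longleftrightarrow> (\<exists>v. (last S, v) \<in> Rel1 M \<and> sat M (S @ [v]) \<phi>)"
| "sat M S (DiaMinus1 \<phi>) \<longleftrightarrow> (\<exists>l \<in> links S - Rel2 M. sat (delete M l) (cut S l) \<phi>)"
| "sat M S (DiaMinus2 \<phi>) \<longleftrightarrow> (\<exists>l \<in> (Rel1 M - Rel2 M) - links S. sat (delete M l) S \<phi>)"
| "sat M S (DiaPlus \<phi>) \<longleftrightarrow> (\<exists>l \<in> Rel2 M - Rel1 M. sat (add M l) S \<phi>)"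

definition learning_modal_equivalent ::
    "('w, 'p) model \<Rightarrow> 'w list \<Rightarrow> ('v, 'p) model \<Rightarrow> 'v list \<Rightarrow> bool" where
  "learning_modal_equivalent M S M' S' \<longleftrightarrow> (\<forall>\<phi>. sat M S \<phi> \<longleftrightarrow> sat M' S' \<phi>)"


section \<open>Bisimulation\<close>

type_synonym ('w, 'p) pointed = "('w, 'p) model \<times> 'w list"

inductive_set U :: "(('w, 'p) pointed \<times> ('w, 'p) pointed) set" where
  "l \<in> links S - Rel2 M \<Longrightarrow> ((M, S), (delete M l, cut S l)) \<in> U"
| "l \<in> (Rel1 M - Rel2 M) - links S \<Longrightarrow> ((M, S), (delete M l, S)) \<in> U"
| "l \<in> Rel2 M - Rel1 M \<Longrightarrow> ((M, S), (add M l, S)) \<in> U"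

inductive_set learner :: "(('w, 'p) pointed \<times> ('w, 'p) pointed) set" where
  "(last S, v) \<in> Rel1 M \<Longrightarrow> ((M, S), (M, S @ [v])) \<in> learner"

text \<open>
  The back-and-forth clause for \<open>DiaL\<close> asks that pairs of paths extended by a learner move be
  related again. The range of a bisimulation must therefore be closed under these moves, which
  \<open>U\<close> alone does not provide: its steps never lengthen a path. Hence the closure is taken of
  \<open>U \<union> learner\<close>.
\<close>

definition reachable :: "('w, 'p) pointed \<Rightarrow> ('w, 'p) pointed set" where
  "reachable P = (U \<union> learner)\<^sup>* `` {P}"

definition atom_harmony :: "(('w, 'p) pointed \<times> ('v, 'p) pointed) set \<Rightarrow> bool" where
  "atom_harmony Z \<longleftrightarrow> (\<forall>N T N' T'. ((N, T), (N', T')) \<in> Z \<longrightarrow>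
     (\<forall>p. sat N T (Atom p) \<longleftrightarrow> sat N' T' (Atom p)))"

definition zig_L :: "(('w, 'p) pointed \<times> ('v, 'p) pointed) set \<Rightarrow> bool" where
  "zig_L Z \<longleftrightarrow> (\<forall>N T N' T'. ((N, T), (N', T')) \<in> Z \<longrightarrow>
     (\<forall>v. (last T, v) \<in> Rel1 N \<longrightarrow>
       (\<exists>v'. (last T', v') \<in> Rel1 N' \<and> ((N, T @ [v]), (N', T' @ [v'])) \<in> Z)))"

definition zig_minus1 :: "(('w, 'p) pointed \<times> ('v, 'p) pointed) set \<Rightarrow> bool" where
  "zig_minus1 Z \<longleftrightarrow> (\<forall>N T N' T'. ((N, T), (N', T')) \<in> Z \<longrightarrow>
     (\<forall>l \<in> links T - Rel2 N. \<exists>l' \<in> links T' - Rel2 N'.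
       ((delete N l, cut T l), (delete N' l', cut T' l')) \<in> Z))"

definition zig_minus2 :: "(('w, 'p) pointed \<times> ('v, 'p) pointed) set \<Rightarrow> bool" where
  "zig_minus2 Z \<longleftrightarrow> (\<forall>N T N' T'. ((N, T), (N', T')) \<in> Z \<longrightarrow>
     (\<forall>l \<in> (Rel1 N - Rel2 N) - links T. \<exists>l' \<in> (Rel1 N' - Rel2 N') - links T'.
       ((delete N l, T), (delete N' l', T')) \<in> Z))"

definition zig_plus :: "(('w, 'p) pointed \<times> ('v, 'p) pointed) set \<Rightarrow> bool" where
  "zig_plus Z \<longleftrightarrow> (\<forall>N T N' T'. ((N, T), (N', T')) \<in> Z \<longrightarrow>
     (\<forall>l \<in> Rel2 N - Rel1 N. \<exists>l' \<in> Rel2 N' - Rel1 N'.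
       ((add N l, T), (add N' l', T')) \<in> Z))"

text \<open>The Zag clauses for \<open>Z\<close> are the Zig clauses for its converse.\<close>

definition l_bisimulation ::
    "(('w, 'p) pointed \<times> ('v, 'p) pointed) set \<Rightarrow>
     ('w, 'p) pointed \<Rightarrow> ('v, 'p) pointed \<Rightarrow> bool" where
  "l_bisimulation Z P P' \<longleftrightarrow>
     Z \<noteq> {} \<and> Z \<subseteq> reachable P \<times> reachable P' \<and> (P, P') \<in> Z \<and> atom_harmony Z \<and>
     zig_L Z \<and> zig_minus1 Z \<and> zig_minus2 Z \<and> zig_plus Z \<and>
     zig_L (Z\<inverse>) \<and> zig_minus1 (Z\<inverse>) \<and> zig_minus2 (Z\<inverse>) \<and> zig_plus (Z\<inverse>)"


section \<open>First-order saturation\<close>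

text \<open>
  Formulas of the first-order correspondence language, expanded with a constant for every element
  of the type \<open>'w\<close>, which denotes that element. The language with constants for \<open>Y\<close> consists of the
  formulas \<open>\<phi>\<close> with \<open>fo_consts \<phi> \<subseteq> Y\<close>.
\<close>

datatype 'w fo_term = Var nat | Const 'w

datatype ('w, 'p) fo_form =
    FPred 'p "'w fo_term"
  | FRel1 "'w fo_term" "'w fo_term"
  | FRel2 "'w fo_term" "'w fo_term"
  | FEq "'w fo_term" "'w fo_term"
  | FNeg "('w, 'p) fo_form"
  | FAnd "('w, 'p) fo_form" "('w, 'p) fo_form"
  | FEx nat "('w, 'p) fo_form"

fun term_consts :: "'w fo_term \<Rightarrow> 'w set" where
  "term_consts (Var x) = {}"
| "term_consts (Const a) = {a}"

fun term_vars :: "'w fo_term \<Rightarrow> nat set" where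
  "term_vars (Var x) = {x}"
| "term_vars (Const a) = {}"

fun term_val :: "(nat \<Rightarrow> 'w) \<Rightarrow> 'w fo_term \<Rightarrow> 'w" where
  "term_val s (Var x) = s x"
| "term_val s (Const a) = a"

primrec fo_consts :: "('w, 'p) fo_form \<Rightarrow> 'w set" where
  "fo_consts (FPred p t) = term_consts t"
| "fo_consts (FRel1 t u) = term_consts t \<union> term_consts u"
| "fo_consts (FRel2 t u) = term_consts t \<union> term_consts u"
| "fo_consts (FEq t u) = term_consts t \<union> term_consts u"
| "fo_consts (FNeg \<phi>) = fo_consts \<phi>"
| "fo_consts (FAnd \<phi> \<psi>) = fo_consts \<phi> \<union> fo_consts \<psi>"
| "fo_consts (FEx x \<phi>) = fo_consts \<phi>"

primrec fo_free :: "('w, 'p) fo_form \<Rightarrow> nat set" where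
  "fo_free (FPred p t) = term_vars t"
| "fo_free (FRel1 t u) = term_vars t \<union> term_vars u"
| "fo_free (FRel2 t u) = term_vars t \<union> term_vars u"
| "fo_free (FEq t u) = term_vars t \<union> term_vars u"
| "fo_free (FNeg \<phi>) = fo_free \<phi>"
| "fo_free (FAnd \<phi> \<psi>) = fo_free \<phi> \<union> fo_free \<psi>"
| "fo_free (FEx x \<phi>) = fo_free \<phi> - {x}"

primrec fo_sat :: "('w, 'p) model \<Rightarrow> (nat \<Rightarrow> 'w) \<Rightarrow> ('w, 'p) fo_form \<Rightarrow> bool" where
  "fo_sat M s (FPred p t) \<longleftrightarrow> term_val s t \<in> Val M p"
| "fo_sat M s (FRel1 t u) \<longleftrightarrow> (term_val s t, term_val s u) \<in> Rel1 M"
| "fo_sat M s (FRel2 t u) \<longleftrightarrow> (term_val s t, term_val s u) \<in> Rel2 M"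
| "fo_sat M s (FEq t u) \<longleftrightarrow> term_val s t = term_val s u"
| "fo_sat M s (FNeg \<phi>) \<longleftrightarrow> \<not> fo_sat M s \<phi>"
| "fo_sat M s (FAnd \<phi> \<psi>) \<longleftrightarrow> fo_sat M s \<phi> \<and> fo_sat M s \<psi>"
| "fo_sat M s (FEx x \<phi>) \<longleftrightarrow> (\<exists>a \<in> Worlds M. fo_sat M (s(x := a)) \<phi>)"

definition realizes :: "('w, 'p) model \<Rightarrow> ('w, 'p) fo_form set \<Rightarrow> bool" where
  "realizes M \<Gamma> \<longleftrightarrow> (\<exists>s. range s \<subseteq> Worlds M \<and> (\<forall>\<phi> \<in> \<Gamma>. fo_sat M s \<phi>))"

definition omega_saturated :: "('w, 'p) model \<Rightarrow> bool" where
  "omega_saturated M \<longleftrightarrow>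
     (\<forall>Y X \<Gamma>. finite Y \<and> Y \<subseteq> Worlds M \<and> finite X \<and>
        (\<forall>\<phi> \<in> \<Gamma>. fo_consts \<phi> \<subseteq> Y \<and> fo_free \<phi> \<subseteq> X) \<and>
        (\<forall>\<Delta>. finite \<Delta> \<and> \<Delta> \<subseteq> \<Gamma> \<longrightarrow> realizes M \<Delta>)
        \<longrightarrow> realizes M \<Gamma>)"

end

theory Submission imports Defs begin

text \<open>
  Every pointed model reachable from \<open>(M, S)\<close> arises from \<open>M\<close> by finitely many edge edits, and its
  path is finite. Treating edits and path as lists of first-order terms, satisfaction of a learning
  formula in the edited model becomes first-order definable over \<open>M\<close> itself, so \<open>\<omega>\<close>-saturation
  of \<open>M\<close> alone makes every set of successors of a reachable pointed model compact with respect to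
  learning formulas. Modal equivalence is then a bisimulation by the Hennessy--Milner argument.
\<close>

section \<open>Definable properties of valuations and their closure under first-order
  operations\<close>

section \<open>First-order definability\<close>

text \<open>Predicates on valuations stand in for formulas, so that no explicit translation of
  learning formulas has to be written. Agreement is asked only for valuations into
  \<open>Worlds M\<close>, the ones considered by \<open>realizes\<close>.\<close>

definition definable ::
    "('w, 'p) model \<Rightarrow> 'w set \<Rightarrow> nat set \<Rightarrow> ((nat \<Rightarrow> 'w) \<Rightarrow> bool) \<Rightarrow> bool" where
  "definable M Y X P \<longleftrightarrow> (\<exists>\<phi>. fo_consts \<phi> \<subseteq> Y \<and> fo_free \<phi> \<subseteq> X \<and>
     (\<forall>s. range s \<subseteq> Worlds M \<longrightarrow> (fo_sat M s \<phi> \<longleftrightarrow> P s)))"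

definition term_over :: "'w set \<Rightarrow> nat set \<Rightarrow> 'w fo_term \<Rightarrow> bool" where
  "term_over Y X t \<longleftrightarrow> term_consts t \<subseteq> Y \<and> term_vars t \<subseteq> X"

lemma definableI:
  assumes "fo_consts \<phi> \<subseteq> Y" "fo_free \<phi> \<subseteq> X"
    and "\<And>s. range s \<subseteq> Worlds M \<Longrightarrow> fo_sat M s \<phi> \<longleftrightarrow> P s"
  shows "definable M Y X P"
  using assms unfolding definable_def by blast

lemma definable_cong:
  assumes "definable M Y X P" and "\<And>s. range s \<subseteq> Worlds M \<Longrightarrow> P s \<longleftrightarrow> Q s"
  shows "definable M Y X Q"
  using assms unfolding definable_def by auto

lemma definable_not: "definable M Y X P \<Longrightarrow> definable M Y X (\<lambda>s. \<not> P s)"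
  unfolding definable_def by (metis fo_consts.simps(5) fo_free.simps(5) fo_sat.simps(5))

lemma definable_and:
  assumes "definable M Y X P" "definable M Y X Q"
  shows "definable M Y X (\<lambda>s. P s \<and> Q s)"
proof -
  obtain \<phi> \<psi> where
    "fo_consts \<phi> \<subseteq> Y" "fo_free \<phi> \<subseteq> X" "\<forall>s. range s \<subseteq> Worlds M \<longrightarrow> (fo_sat M s \<phi> \<longleftrightarrow> P s)"
    "fo_consts \<psi> \<subseteq> Y" "fo_free \<psi> \<subseteq> X" "\<forall>s. range s \<subseteq> Worlds M \<longrightarrow> (fo_sat M s \<psi> \<longleftrightarrow> Q s)"
    using assms unfolding definable_def by blast
  then show ?thesis by (intro definableI[of "FAnd \<phi> \<psi>"]) auto
qed

lemma definable_or:
  assumes "definable M Y X P" "definable M Y X Q"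
  shows "definable M Y X (\<lambda>s. P s \<or> Q s)"
  by (rule definable_cong[OF definable_not[OF definable_and[OF definable_not definable_not]]])
     (use assms in auto)

lemma definable_exists:
  assumes "definable M Y (insert x X) P"
  shows "definable M Y X (\<lambda>s. \<exists>a\<in>Worlds M. P (s(x := a)))"
proof -
  obtain \<phi> where \<phi>: "fo_consts \<phi> \<subseteq> Y" "fo_free \<phi> \<subseteq> insert x X"
    "\<And>s. range s \<subseteq> Worlds M \<Longrightarrow> fo_sat M s \<phi> \<longleftrightarrow> P s"
    using assms unfolding definable_def by blast
  have "range (s(x := a)) \<subseteq> Worlds M" if "range s \<subseteq> Worlds M" "a \<in> Worlds M" for s a
    using that by auto
  with \<phi> show ?thesis by (intro definableI[of "FEx x \<phi>"]) auto
qed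

lemma definable_False: "definable M Y X (\<lambda>s. False)"
  \<comment> \<open>The syntax has no falsum; a sentence without constants is used so that any
    \<open>X\<close> and \<open>Y\<close>, even empty ones, are allowed.\<close>
  by (rule definableI[of "FEx 0 (FNeg (FEq (Var 0) (Var 0)))"]) auto

lemma definable_finite_exists:
  assumes "finite I" "\<And>i. i \<in> I \<Longrightarrow> definable M Y X (P i)"
  shows "definable M Y X (\<lambda>s. \<exists>i\<in>I. P i s)"
  using assms
proof (induction I)
  case empty
  then show ?case using definable_False by simp
next
  case (insert i I)
  then have "definable M Y X (\<lambda>s. P i s \<or> (\<exists>i\<in>I. P i s))"
    by (intro definable_or) auto
  then show ?case by simp
qed

lemma definable_finite_forall:
  assumes "finite I" "\<And>i. i \<in> I \<Longrightarrow> definable M Y X (P i)"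
  shows "definable M Y X (\<lambda>s. \<forall>i\<in>I. P i s)"
  by (rule definable_cong[OF definable_not[OF definable_finite_exists[of I _ _ _ "\<lambda>i s. \<not> P i s"]]])
     (simp_all add: assms definable_not)

lemma definable_pred:
  "term_over Y X t \<Longrightarrow> definable M Y X (\<lambda>s. term_val s t \<in> Val M p)"
  by (rule definableI[of "FPred p t"]) (auto simp: term_over_def)

lemma definable_Rel1:
  "term_over Y X t \<Longrightarrow> term_over Y X u \<Longrightarrow>
    definable M Y X (\<lambda>s. (term_val s t, term_val s u) \<in> Rel1 M)"
  by (rule definableI[of "FRel1 t u"]) (auto simp: term_over_def)

lemma definable_Rel2:
  "term_over Y X t \<Longrightarrow> term_over Y X u \<Longrightarrow>
    definable M Y X (\<lambda>s. (term_val s t, term_val s u) \<in> Rel2 M)"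
  by (rule definableI[of "FRel2 t u"]) (auto simp: term_over_def)

lemma definable_eq:
  "term_over Y X t \<Longrightarrow> term_over Y X u \<Longrightarrow> definable M Y X (\<lambda>s. term_val s t = term_val s u)"
  by (rule definableI[of "FEq t u"]) (auto simp: term_over_def)

lemma term_over_mono:
  "term_over Y X t \<Longrightarrow> Y \<subseteq> Y' \<Longrightarrow> X \<subseteq> X' \<Longrightarrow> term_over Y' X' t"
  unfolding term_over_def by blast

lemma term_val_upd: "term_over Y X t \<Longrightarrow> x \<notin> X \<Longrightarrow> term_val (s(x := a)) t = term_val s t"
  unfolding term_over_def by (cases t) auto

lemma term_val_in_Worlds:
  "term_over Y X t \<Longrightarrow> Y \<subseteq> Worlds M \<Longrightarrow> range s \<subseteq> Worlds M \<Longrightarrow> term_val s t \<in> Worlds M"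
  unfolding term_over_def by (cases t) auto


section \<open>Families of edited pointed models, indexed by valuations\<close>

section \<open>Symbolically edited models\<close>

text \<open>The Boolean component of an edit says whether the edge is added or deleted.\<close>

type_synonym 'w edit = "bool \<times> 'w fo_term \<times> 'w fo_term"

text \<open>The head of the list is the latest edit. As endpoints are terms, one list describes a
  whole family of models, one for each valuation.\<close>

fun edited :: "('w, 'p) model \<Rightarrow> (nat \<Rightarrow> 'w) \<Rightarrow> 'w edit list \<Rightarrow> ('w, 'p) model" where
  "edited M s [] = M"
| "edited M s ((b, t, u) # E) =
     (if b then add else delete) (edited M s E) (term_val s t, term_val s u)"

text \<open>\<open>Y\<close> and \<open>X\<close> are going to be the parameters and the variables
  of the first-order types to which saturation is applied.\<close>

definition symbolic ::
    "('w, 'p) model \<Rightarrow> 'w set \<Rightarrow> nat set \<Rightarrow> 'w edit list \<Rightarrow> 'w fo_term list \<Rightarrow> bool" where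
  "symbolic M Y X E ts \<longleftrightarrow> is_model M \<and> Y \<subseteq> Worlds M \<and> ts \<noteq> [] \<and>
     (\<forall>t\<in>set ts. term_over Y X t) \<and>
     (\<forall>(b, t, u)\<in>set E. term_over Y X t \<and> term_over Y X u)"

section \<open>Bookkeeping for edited models: worlds, fresh variables, change of parameters\<close>

lemma Rel2_edited [simp]: "Rel2 (edited M s E) = Rel2 M"
  by (induction M s E rule: edited.induct) (auto simp: add_def delete_def)

lemma Val_edited [simp]: "Val (edited M s E) = Val M"
  by (induction M s E rule: edited.induct) (auto simp: add_def delete_def)

lemma symbolic_Cons_edit:
  "symbolic M Y X ((b, t, u) # E) ts \<longleftrightarrow>
    symbolic M Y X E ts \<and> term_over Y X t \<and> term_over Y X u"
  unfolding symbolic_def by auto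

text \<open>Mediates between \<open>sat\<close>, whose quantifiers over worlds and edges run over
  the whole type, and \<open>FEx\<close>, which is bounded by \<open>Worlds M\<close>.\<close>

lemma Rel1_edited_subset:
  assumes "symbolic M Y X E ts" "range s \<subseteq> Worlds M"
  shows "Rel1 (edited M s E) \<subseteq> Worlds M \<times> Worlds M"
  using assms(1)
proof (induction E)
  case Nil
  then show ?case by (simp add: symbolic_def is_model_def)
next
  case (Cons e E)
  obtain b t u where e: "e = (b, t, u)" by (cases e)
  have IH: "Rel1 (edited M s E) \<subseteq> Worlds M \<times> Worlds M"
    using Cons by (simp add: e symbolic_Cons_edit)
  have "Y \<subseteq> Worlds M" using Cons.prems by (simp add: symbolic_def)
  moreover have "term_over Y X t" "term_over Y X u"
    using Cons.prems by (simp_all add: e symbolic_Cons_edit)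
  ultimately have "term_val s t \<in> Worlds M" "term_val s u \<in> Worlds M"
    using assms(2) by (auto intro: term_val_in_Worlds)
  with IH show ?case by (auto simp: e add_def delete_def)
qed

text \<open>A fresh variable occurs in no edit, so quantifying over it leaves the described model
  alone; \<open>path_upd\<close> does the same for the path.\<close>

lemma edited_upd:
  assumes "symbolic M Y X E ts" "x \<notin> X"
  shows "edited M (s(x := a)) E = edited M s E"
  using assms(1)
proof (induction E)
  case (Cons e E)
  obtain b t u where e: "e = (b, t, u)" by (cases e)
  have IH: "edited M (s(x := a)) E = edited M s E"
    by (rule Cons.IH) (use Cons.prems in \<open>simp add: e symbolic_Cons_edit\<close>)
  have "term_over Y X t" "term_over Y X u"
    using Cons.prems by (simp_all add: e symbolic_Cons_edit)
  with IH show ?case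
    by (simp only: e edited.simps term_val_upd[OF _ assms(2)])
qed simp

lemma path_upd:
  assumes "symbolic M Y X E ts" "x \<notin> X"
  shows "map (term_val (s(x := a))) ts = map (term_val s) ts"
  using assms by (auto simp: symbolic_def intro: term_val_upd)

lemma symbolic_mono:
  assumes sym: "symbolic M Y X E ts" and subset: "Y \<subseteq> Y'" "Y' \<subseteq> Worlds M" "X \<subseteq> X'"
  shows "symbolic M Y' X' E ts"
proof -
  have "term_over Y' X' t" if "term_over Y X t" for t
    using that subset(1,3) by (rule term_over_mono)
  then show ?thesis using sym subset(2) unfolding symbolic_def by auto
qed

lemma symbolic_edit:
  "symbolic M Y X E ts \<Longrightarrow> term_over Y X t \<Longrightarrow> term_over Y X u \<Longrightarrow> symbolic M Y X ((b, t, u) # E) ts"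
  by (simp add: symbolic_Cons_edit)

lemma symbolic_snoc:
  "symbolic M Y X E ts \<Longrightarrow> term_over Y X t \<Longrightarrow> symbolic M Y X E (ts @ [t])"
  unfolding symbolic_def by auto

lemma symbolic_take: "symbolic M Y X E ts \<Longrightarrow> symbolic M Y X E (take (Suc i) ts)"
  unfolding symbolic_def by (auto dest: in_set_takeD)

lemma symbolic_nth: "symbolic M Y X E ts \<Longrightarrow> i < length ts \<Longrightarrow> term_over Y X (ts ! i)"
  unfolding symbolic_def by auto

lemma symbolic_last: "symbolic M Y X E ts \<Longrightarrow> term_over Y X (last ts)"
  unfolding symbolic_def by auto

lemma last_path: "symbolic M Y X E ts \<Longrightarrow> last (map (term_val s) ts) = term_val s (last ts)"
  unfolding symbolic_def by (simp add: last_map)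

text \<open>Adding a pair contributes a disjunct that equates both endpoints, deleting it a negated
  conjunct. Membership thus unfolds into \<open>Rel1 M\<close> and finitely many equations between
  terms.\<close>

lemma definable_Rel1_edited:
  assumes "symbolic M Y X E ts" and t: "term_over Y X t" and u: "term_over Y X u"
  shows "definable M Y X (\<lambda>s. (term_val s t, term_val s u) \<in> Rel1 (edited M s E))"
  using assms(1)
proof (induction E)
  case Nil
  then show ?case using definable_Rel1[OF t u] by simp
next
  case (Cons e E)
  obtain b t' u' where e: "e = (b, t', u')" by (cases e)
  have IH: "definable M Y X (\<lambda>s. (term_val s t, term_val s u) \<in> Rel1 (edited M s E))"
    using Cons by (simp add: e symbolic_Cons_edit)
  have tu': "term_over Y X t'" "term_over Y X u'"
    using Cons.prems by (simp_all add: e symbolic_Cons_edit)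
  have eq: "definable M Y X (\<lambda>s. term_val s t = term_val s t' \<and> term_val s u = term_val s u')"
    by (intro definable_and definable_eq t u tu')
  show ?case
  proof (cases b)
    case True
    then show ?thesis
      by (intro definable_cong[OF definable_or[OF IH eq]]) (auto simp: e add_def)
  next
    case False
    then show ?thesis
      by (intro definable_cong[OF definable_and[OF IH definable_not[OF eq]]]) (auto simp: e delete_def)
  qed
qed

section \<open>Quantification over path links and over edges\<close>

lemma mem_links:
  "(a, b) \<in> links S \<longleftrightarrow> (\<exists>i\<in>{i. Suc i < length S}. a = S ! i \<and> b = S ! Suc i)"
  by (auto simp: links_def)

text \<open>The entries of the path vary with the valuation but its length does not, so a finite
  disjunction over positions suffices.\<close>

lemma definable_links:
  assumes "symbolic M Y X E ts" "term_over Y X t" "term_over Y X u"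
  shows "definable M Y X (\<lambda>s. (term_val s t, term_val s u) \<in> links (map (term_val s) ts))"
proof (rule definable_cong)
  show "definable M Y X (\<lambda>s. \<exists>i\<in>{i. Suc i < length ts}.
      term_val s t = term_val s (ts ! i) \<and> term_val s u = term_val s (ts ! Suc i))"
  proof (rule definable_finite_exists)
    show "finite {i. Suc i < length ts}"
      by (rule finite_subset[of _ "{..<length ts}"]) auto
  qed (auto intro!: definable_and definable_eq assms symbolic_nth[OF assms(1)])
qed (unfold mem_links, rule bex_cong, auto)

text \<open>Each link is replaced by the position of its first occurrence. The \<open>LEAST\<close>
  in \<open>cut\<close> becomes finitely many inequations, and the cut becomes a prefix whose length
  no longer depends on the values of the path.\<close>

lemma bex_links_cut:
  "(\<exists>l\<in>links S - R. Q l (cut S l)) \<longleftrightarrow>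
   (\<exists>i\<in>{i. Suc i < length S}. (S ! i, S ! Suc i) \<notin> R \<and>
      (\<forall>j\<in>{..<i}. \<not> (S ! j = S ! i \<and> S ! Suc j = S ! Suc i)) \<and>
      Q (S ! i, S ! Suc i) (take (Suc i) S))" (is "?L \<longleftrightarrow> ?R")
proof
  assume ?L
  then obtain l where l: "l \<in> links S" "l \<notin> R" "Q l (cut S l)" by blast
  define i where "i = (LEAST u. Suc u < length S \<and> (S ! u, S ! Suc u) = l)"
  have "\<exists>u. Suc u < length S \<and> (S ! u, S ! Suc u) = l"
    using l(1) by (auto simp: links_def)
  then have i: "Suc i < length S \<and> (S ! i, S ! Suc i) = l"
    unfolding i_def by (rule LeastI_ex)
  have "\<not> (Suc j < length S \<and> (S ! j, S ! Suc j) = l)" if "j < i" for j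
    using that unfolding i_def by (rule not_less_Least)
  \<comment> \<open>For \<open>j < i\<close> the bound \<open>Suc j < length S\<close> follows from
    the one for \<open>i\<close>, so minimality only says that the links differ.\<close>
  then have "\<forall>j\<in>{..<i}. \<not> (S ! j = S ! i \<and> S ! Suc j = S ! Suc i)"
    using i by force
  moreover have "cut S l = take (Suc i) S"
    unfolding cut_def i_def ..
  ultimately show ?R using l i by auto
next
  assume ?R
  then obtain i where i: "Suc i < length S" "(S ! i, S ! Suc i) \<notin> R"
    "\<forall>j\<in>{..<i}. \<not> (S ! j = S ! i \<and> S ! Suc j = S ! Suc i)"
    "Q (S ! i, S ! Suc i) (take (Suc i) S)" by blast
  have "(LEAST u. Suc u < length S \<and> (S ! u, S ! Suc u) = (S ! i, S ! Suc i)) = i"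
    using i by (intro Least_equality) (auto simp: not_less[symmetric])
  then have "cut S (S ! i, S ! Suc i) = take (Suc i) S"
    by (simp add: cut_def)
  moreover have "(S ! i, S ! Suc i) \<in> links S"
    using i(1) by (auto simp: links_def)
  ultimately show ?L using i by (intro bexI[of _ "(S ! i, S ! Suc i)"]) auto
qed

text \<open>Two fresh variables name the endpoints of the edge: \<open>cong\<close> keeps their
  values from affecting \<open>P\<close> elsewhere, and \<open>subset\<close> turns the quantifiers
  over \<open>Worlds M\<close> into one over all pairs.\<close>

lemma definable_exists_edge:
  assumes "x \<noteq> y"
    and D: "definable M Y (insert x (insert y X)) (\<lambda>s. P s (s x, s y))"
    and cong: "\<And>s a b. P (s(y := b, x := a)) = P s"
    and subset: "\<And>s l. range s \<subseteq> Worlds M \<Longrightarrow> P s l \<Longrightarrow> l \<in> Worlds M \<times> Worlds M"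
  shows "definable M Y X (\<lambda>s. \<exists>l. P s l)"
proof (rule definable_cong[OF definable_exists[OF definable_exists[OF D]]])
  fix s :: "nat \<Rightarrow> 'a"
  assume "range s \<subseteq> Worlds M"
  then show "(\<exists>b\<in>Worlds M. \<exists>a\<in>Worlds M. P (s(y := b, x := a))
      ((s(y := b, x := a)) x, (s(y := b, x := a)) y)) \<longleftrightarrow> (\<exists>l. P s l)"
    using assms(1) subset unfolding cong by fastforce
qed

text \<open>This is the standard translation, in semantic form. \<open>X\<close>, \<open>E\<close>
  and \<open>ts\<close> vary in the induction because modalities extend the edits, change the path
  and bring in variables; finiteness of \<open>X\<close> keeps fresh variables available.\<close>

lemma definable_sat:
  assumes "symbolic M Y X E ts" "finite X"
  shows "definable M Y X (\<lambda>s. sat (edited M s E) (map (term_val s) ts) \<phi>)"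
  using assms
proof (induction \<phi> arbitrary: X E ts)
  case (Atom p)
  then show ?case
    using definable_pred[OF symbolic_last] by (simp add: last_path)
next
  case (Neg \<phi>)
  then show ?case by (simp add: definable_not)
next
  case (And \<phi> \<psi>)
  then show ?case by (simp add: definable_and)
next
  case (DiaL \<phi>)
  note sym = DiaL.prems(1)
  obtain x where x: "x \<notin> X" using DiaL.prems(2) ex_new_if_finite infinite_UNIV_nat by blast
  let ?X = "insert x X"
  have Y: "Y \<subseteq> Worlds M" using sym by (simp add: symbolic_def)
  have sym': "symbolic M Y ?X E ts" by (rule symbolic_mono[OF sym _ Y]) auto
  have ov: "term_over Y ?X (Var x)" by (simp add: term_over_def)
  \<comment> \<open>The learner's move appends the fresh variable \<open>Var x\<close> to the
    symbolic path.\<close>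
  have "definable M Y ?X (\<lambda>s.
      (term_val s (last ts), term_val s (Var x)) \<in> Rel1 (edited M s E) \<and>
      sat (edited M s E) (map (term_val s) (ts @ [Var x])) \<phi>)"
    by (intro definable_and definable_Rel1_edited[OF sym'] DiaL.IH symbolic_last[OF sym'] ov
        symbolic_snoc[OF sym']) (use DiaL.prems in auto)
  from definable_exists[OF this] show ?case
  proof (rule definable_cong)
    fix s :: "nat \<Rightarrow> 'a"
    assume s: "range s \<subseteq> Worlds M"
    show "(\<exists>a\<in>Worlds M.
        (term_val (s(x := a)) (last ts), term_val (s(x := a)) (Var x)) \<in> Rel1 (edited M (s(x := a)) E) \<and>
        sat (edited M (s(x := a)) E) (map (term_val (s(x := a))) (ts @ [Var x])) \<phi>) \<longleftrightarrow>
      sat (edited M s E) (map (term_val s) ts) (DiaL \<phi>)"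
      using Rel1_edited_subset[OF sym s]
      by (auto simp: edited_upd[OF sym x] path_upd[OF sym x] last_path[OF sym]
          term_val_upd[OF symbolic_last[OF sym] x] simp del: map_eq_conv)
  qed
next
  case (DiaMinus1 \<phi>)
  note sym = DiaMinus1.prems(1)
  \<comment> \<open>The deleted link joins two consecutive entries of the path, so terms for it are
    already there and only its first position \<open>i\<close> is guessed.\<close>
  have "definable M Y X (\<lambda>s. \<exists>i\<in>{i. Suc i < length ts}.
      \<not> (term_val s (ts ! i), term_val s (ts ! Suc i)) \<in> Rel2 M \<and>
      (\<forall>j\<in>{..<i}. \<not> (term_val s (ts ! j) = term_val s (ts ! i) \<and>
                     term_val s (ts ! Suc j) = term_val s (ts ! Suc i))) \<and>
      sat (edited M s ((False, ts ! i, ts ! Suc i) # E)) (map (term_val s) (take (Suc i) ts)) \<phi>)"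
  proof (rule definable_finite_exists)
    show "finite {i. Suc i < length ts}"
      by (rule finite_subset[of _ "{..<length ts}"]) auto
  qed (intro definable_and definable_not definable_finite_forall definable_Rel2 definable_eq
      DiaMinus1.IH symbolic_edit symbolic_take symbolic_nth[OF sym] sym DiaMinus1.prems(2);
      simp)
  then show ?case
    unfolding sat.simps
    by (rule definable_cong) (subst bex_links_cut, auto simp: take_map)
next
  case (DiaMinus2 \<phi>)
  note sym = DiaMinus2.prems(1)
  obtain y where y: "y \<notin> X" using DiaMinus2.prems(2) ex_new_if_finite infinite_UNIV_nat by blast
  obtain x where x: "x \<notin> insert y X"
    using DiaMinus2.prems(2) ex_new_if_finite infinite_UNIV_nat by blast
  let ?X = "insert x (insert y X)"
  have Y: "Y \<subseteq> Worlds M" using sym by (simp add: symbolic_def)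
  have sym1: "symbolic M Y (insert y X) E ts" by (rule symbolic_mono[OF sym _ Y]) auto
  have sym': "symbolic M Y ?X E ts" by (rule symbolic_mono[OF sym _ Y]) auto
  have ov: "term_over Y ?X (Var x)" "term_over Y ?X (Var y)" by (simp_all add: term_over_def)
  have D: "definable M Y ?X (\<lambda>s.
      (((term_val s (Var x), term_val s (Var y)) \<in> Rel1 (edited M s E) \<and>
       \<not> (term_val s (Var x), term_val s (Var y)) \<in> Rel2 M) \<and>
       \<not> (term_val s (Var x), term_val s (Var y)) \<in> links (map (term_val s) ts)) \<and>
      sat (edited M s ((False, Var x, Var y) # E)) (map (term_val s) ts) \<phi>)"
    by (intro definable_and definable_not definable_Rel1_edited[OF sym'] definable_Rel2
        definable_links[OF sym'] DiaMinus2.IH symbolic_edit[OF sym'] ov)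
      (use DiaMinus2.prems in auto)
  \<comment> \<open>The edge is separated from the valuation, which now matters only through its
    values on \<open>X\<close>.\<close>
  let ?P = "\<lambda>s l. l \<in> Rel1 (edited M s E) - Rel2 M - links (map (term_val s) ts) \<and>
    sat (delete (edited M s E) l) (map (term_val s) ts) \<phi>"
  have "definable M Y X (\<lambda>s. \<exists>l. ?P s l)"
  proof (rule definable_exists_edge[where P = ?P])
    show "x \<noteq> y" using x by auto
    show "definable M Y ?X (\<lambda>s. ?P s (s x, s y))" using D by simp
    show "?P (s(y := b, x := a)) = ?P s" for s a b
      \<comment> \<open>The updates are peeled off one by one: \<open>x\<close> is fresh for
        \<open>insert y X\<close>, then \<open>y\<close> for \<open>X\<close>.\<close>
      by (simp only: edited_upd[OF sym1 x] path_upd[OF sym1 x] edited_upd[OF sym y] path_upd[OF sym y])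
  qed (use Rel1_edited_subset[OF sym] in blast)
  then show ?case by (simp add: Bex_def)
next
  case (DiaPlus \<phi>)
  note sym = DiaPlus.prems(1)
  obtain y where y: "y \<notin> X" using DiaPlus.prems(2) ex_new_if_finite infinite_UNIV_nat by blast
  obtain x where x: "x \<notin> insert y X"
    using DiaPlus.prems(2) ex_new_if_finite infinite_UNIV_nat by blast
  let ?X = "insert x (insert y X)"
  have Y: "Y \<subseteq> Worlds M" using sym by (simp add: symbolic_def)
  have sym1: "symbolic M Y (insert y X) E ts" by (rule symbolic_mono[OF sym _ Y]) auto
  have sym': "symbolic M Y ?X E ts" by (rule symbolic_mono[OF sym _ Y]) auto
  have ov: "term_over Y ?X (Var x)" "term_over Y ?X (Var y)" by (simp_all add: term_over_def)
  have D: "definable M Y ?X (\<lambda>s.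
      ((term_val s (Var x), term_val s (Var y)) \<in> Rel2 M \<and>
       \<not> (term_val s (Var x), term_val s (Var y)) \<in> Rel1 (edited M s E)) \<and>
      sat (edited M s ((True, Var x, Var y) # E)) (map (term_val s) ts) \<phi>)"
    by (intro definable_and definable_not definable_Rel1_edited[OF sym'] definable_Rel2
        DiaPlus.IH symbolic_edit[OF sym'] ov)
      (use DiaPlus.prems in auto)
  let ?P = "\<lambda>s l. l \<in> Rel2 M - Rel1 (edited M s E) \<and>
    sat (add (edited M s E) l) (map (term_val s) ts) \<phi>"
  have "definable M Y X (\<lambda>s. \<exists>l. ?P s l)"
  proof (rule definable_exists_edge[where P = ?P])
    show "x \<noteq> y" using x by auto
    show "definable M Y ?X (\<lambda>s. ?P s (s x, s y))" using D by simp
    show "?P (s(y := b, x := a)) = ?P s" for s a b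
      by (simp only: edited_upd[OF sym1 x] path_upd[OF sym1 x] edited_upd[OF sym y] path_upd[OF sym y])
  next
    \<comment> \<open>Here the bound comes from \<open>Rel2 M\<close>, which no edit
      changes.\<close>
    show "l \<in> Worlds M \<times> Worlds M"
      if "l \<in> Rel2 M - Rel1 (edited M s E) \<and> sat (add (edited M s E) l) (map (term_val s) ts) \<phi>" for s l
      using that sym by (auto simp: symbolic_def is_model_def)
  qed
  then show ?case by (simp add: Bex_def)
qed


section \<open>Naming concrete pointed models by closed terms\<close>

section \<open>Reachable pointed models\<close>

text \<open>The description has no variables, so every valuation yields the same pointed model. Its
  parameters form a finite set, as saturation demands.\<close>

definition represented :: "('w, 'p) model \<Rightarrow> ('w, 'p) pointed \<Rightarrow> bool" where
  "represented M P \<longleftrightarrow> (\<exists>Y E ts. finite Y \<and> symbolic M Y {} E ts \<and>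
     (\<forall>s. edited M s E = fst P \<and> map (term_val s) ts = snd P))"

lemma represented_refl:
  assumes "pointed_model M S"
  shows "represented M (M, S)"
proof -
  have "symbolic M (set S) {} [] (map Const S)"
    using assms by (auto simp: symbolic_def pointed_model_def term_over_def)
  moreover have "map (term_val s) (map Const S) = S" for s
    by (simp add: map_idI)
  ultimately show ?thesis
    unfolding represented_def
    by (intro exI[of _ "set S"] exI[of _ "[]"] exI[of _ "map Const S"]) auto
qed

lemma represented_bounds:
  assumes "represented M (N, T)"
  shows "Rel1 N \<subseteq> Worlds M \<times> Worlds M"
    "Rel2 N \<subseteq> Worlds M \<times> Worlds M" "links T \<subseteq> Worlds M \<times> Worlds M"
proof -
  obtain Y E ts where *: "symbolic M Y {} E ts"
    "\<And>s. edited M s E = N" "\<And>s. map (term_val s) ts = T"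
    using assms by (auto simp: represented_def)
  have M: "is_model M" using * by (simp add: symbolic_def)
  \<comment> \<open>Any valuation into \<open>Worlds M\<close> evaluates the closed description; a
    constant one exists because \<open>Worlds M\<close> is non-empty.\<close>
  obtain w where "w \<in> Worlds M" using M by (auto simp: is_model_def)
  then have w: "range (\<lambda>_::nat. w) \<subseteq> Worlds M" by auto
  show "Rel1 N \<subseteq> Worlds M \<times> Worlds M"
    using Rel1_edited_subset[OF *(1) w] *(2) by simp
  show "Rel2 N \<subseteq> Worlds M \<times> Worlds M"
    using Rel2_edited[of M "\<lambda>_. w" E] M *(2) by (simp add: is_model_def)
  have T: "set T \<subseteq> Worlds M"
  proof -
    have "set (map (term_val (\<lambda>_. w)) ts) \<subseteq> Worlds M"
      using *(1) w by (auto simp: symbolic_def intro: term_val_in_Worlds)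
    then show ?thesis using *(3) by simp
  qed
  show "links T \<subseteq> Worlds M \<times> Worlds M"
    using T by (fastforce simp: links_def)
qed

lemma represented_edit:
  assumes "represented M (N, T)" "l \<in> Worlds M \<times> Worlds M"
  shows "represented M (delete N l, T)" "represented M (add N l, T)"
proof -
  obtain Y E ts where *: "finite Y" "symbolic M Y {} E ts"
    "\<And>s. edited M s E = N" "\<And>s. map (term_val s) ts = T"
    using assms by (auto simp: represented_def)
  obtain a b where l: "l = (a, b)" by (cases l)
  let ?Y = "insert a (insert b Y)"
  have "Y \<subseteq> Worlds M" using *(2) by (simp add: symbolic_def)
  then have "symbolic M ?Y {} E ts"
    using assms(2) l by (intro symbolic_mono[OF *(2)]) auto
  then have "symbolic M ?Y {} ((c, Const a, Const b) # E) ts" for c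
    by (rule symbolic_edit) (auto simp: term_over_def)
  then have "represented M ((if c then add else delete) N l, T)" for c
    unfolding represented_def using *
    by (intro exI[of _ ?Y] exI[of _ "(c, Const a, Const b) # E"] exI[of _ ts]) (simp add: l)
  from this[of False] this[of True]
  show "represented M (delete N l, T)" "represented M (add N l, T)" by simp_all
qed

lemma represented_snoc:
  assumes "represented M (N, T)" "v \<in> Worlds M"
  shows "represented M (N, T @ [v])"
proof -
  obtain Y E ts where *: "finite Y" "symbolic M Y {} E ts"
    "\<And>s. edited M s E = N" "\<And>s. map (term_val s) ts = T"
    using assms by (auto simp: represented_def)
  have "Y \<subseteq> Worlds M" using *(2) by (simp add: symbolic_def)
  then have "symbolic M (insert v Y) {} E ts"
    using assms(2) by (intro symbolic_mono[OF *(2)]) auto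
  then have "symbolic M (insert v Y) {} E (ts @ [Const v])"
    by (rule symbolic_snoc) (auto simp: term_over_def)
  then show ?thesis
    unfolding represented_def using *
    by (intro exI[of _ "insert v Y"] exI[of _ E] exI[of _ "ts @ [Const v]"]) auto
qed

lemma represented_take:
  assumes "represented M (N, T)"
  shows "represented M (N, take (Suc i) T)"
proof -
  obtain Y E ts where *: "finite Y" "symbolic M Y {} E ts"
    "\<And>s. edited M s E = N" "\<And>s. map (term_val s) ts = T"
    using assms by (auto simp: represented_def)
  then show ?thesis
    unfolding represented_def
    by (intro exI[of _ Y] exI[of _ E] exI[of _ "take (Suc i) ts"])
       (simp add: symbolic_take take_map[symmetric])
qed

lemma represented_step:
  assumes "represented M P" "(P, Q) \<in> U \<union> learner"
  shows "represented M Q"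
proof -
  obtain N T where P: "P = (N, T)" by (cases P)
  obtain N' T' where Q: "Q = (N', T')" by (cases Q)
  have rep: "represented M (N, T)" using assms(1) P by simp
  note bounds = represented_bounds[OF rep]
  consider l where "l \<in> links T" "Q = (delete N l, cut T l)"
    | l where "l \<in> Rel1 N" "Q = (delete N l, T)"
    | l where "l \<in> Rel2 N" "Q = (add N l, T)"
    | v where "(last T, v) \<in> Rel1 N" "Q = (N, T @ [v])"
    using assms(2) unfolding P Q by (auto elim!: U.cases learner.cases)
  then show ?thesis
  proof cases
    case 1
    then have "represented M (delete N l, T)"
      using rep bounds(3) by (intro represented_edit(1)) auto
    \<comment> \<open>\<open>cut T l\<close> has the form \<open>take (Suc i) T\<close>, whatever
      the least index \<open>i\<close> is.\<close>
    then show ?thesis using 1 by (simp add: cut_def represented_take)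
  next
    case 2
    then show ?thesis using rep bounds(1) by (auto intro!: represented_edit)
  next
    case 3
    then show ?thesis using rep bounds(2) by (auto intro!: represented_edit)
  next
    case 4
    then show ?thesis using rep bounds(1) by (auto intro!: represented_snoc)
  qed
qed

text \<open>Every step brings in only finitely many new constants, so finitely many steps keep the
  parameter set finite.\<close>

lemma represented_reachable:
  assumes "pointed_model M S" "P \<in> reachable (M, S)"
  shows "represented M P"
proof -
  have "((M, S), P) \<in> (U \<union> learner)\<^sup>*" using assms(2) by (simp add: reachable_def)
  then show ?thesis
    by (induction rule: rtrancl_induct) (auto intro: represented_refl[OF assms(1)] represented_step)
qed


section \<open>From first-order saturation to compactness for learning formulas\<close>

section \<open>Compactness of successor sets\<close>

definition models :: "('w, 'p) pointed \<Rightarrow> 'p form \<Rightarrow> bool" where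
  "models P \<phi> \<longleftrightarrow> sat (fst P) (snd P) \<phi>"

text \<open>For successor sets this is the modal saturation property of Hennessy--Milner theory. The
  case \<open>F = {}\<close> makes the premise fail for empty \<open>D\<close>, so the empty set is
  compact.\<close>

definition modally_compact :: "('w, 'p) pointed set \<Rightarrow> bool" where
  "modally_compact D \<longleftrightarrow> (\<forall>\<Phi>.
     (\<forall>F. finite F \<and> F \<subseteq> \<Phi> \<longrightarrow> (\<exists>P\<in>D. \<forall>\<phi>\<in>F. models P \<phi>)) \<longrightarrow>
     (\<exists>P\<in>D. \<forall>\<phi>\<in>\<Phi>. models P \<phi>))"

lemma modally_compactD:
  assumes "modally_compact D"
    and "\<And>F. finite F \<Longrightarrow> F \<subseteq> \<Phi> \<Longrightarrow> \<exists>P\<in>D. \<forall>\<phi>\<in>F. models P \<phi>"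
  shows "\<exists>P\<in>D. \<forall>\<phi>\<in>\<Phi>. models P \<phi>"
  using assms(1)[unfolded modally_compact_def, THEN spec, of \<Phi>] assms(2) by simp

text \<open>If every member refuted some formula of \<Phi>, one such formula per member would give a
  finite subset of \<Phi> that no member satisfies.\<close>

lemma modally_compact_finite:
  assumes "finite D"
  shows "modally_compact D"
  unfolding modally_compact_def
proof (intro allI impI, rule ccontr)
  fix \<Phi> :: "'b form set"
  assume fin: "\<forall>F. finite F \<and> F \<subseteq> \<Phi> \<longrightarrow> (\<exists>P\<in>D. \<forall>\<phi>\<in>F. models P \<phi>)"
  assume "\<not> (\<exists>P\<in>D. \<forall>\<phi>\<in>\<Phi>. models P \<phi>)"
  then have "\<forall>P\<in>D. \<exists>\<phi>. \<phi> \<in> \<Phi> \<and> \<not> models P \<phi>" by blast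
  then obtain f where f: "\<forall>P\<in>D. f P \<in> \<Phi> \<and> \<not> models P (f P)"
    using bchoice[of D "\<lambda>P \<phi>. \<phi> \<in> \<Phi> \<and> \<not> models P \<phi>"] by blast
  then have "finite (f ` D) \<and> f ` D \<subseteq> \<Phi>" using assms by auto
  then show False using fin f by blast
qed

text \<open>\<Phi> is translated into a first-order type over \<open>M\<close>, together with a
  formula for \<open>C\<close>. A valuation realizing this type picks out a member of the family
  that satisfies \<Phi>.\<close>

lemma modally_compact_definable:
  assumes sat: "omega_saturated M" and sym: "symbolic M Y X E ts" and fin: "finite X" "finite Y"
    and C: "definable M Y X C"
  shows "modally_compact {(edited M s E, map (term_val s) ts) | s. range s \<subseteq> Worlds M \<and> C s}"
    (is "modally_compact ?D")
  unfolding modally_compact_def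
proof (intro allI impI)
  fix \<Phi> :: "'b form set"
  assume fs: "\<forall>F. finite F \<and> F \<subseteq> \<Phi> \<longrightarrow> (\<exists>P\<in>?D. \<forall>\<phi>\<in>F. models P \<phi>)"
  obtain c where c: "fo_consts c \<subseteq> Y" "fo_free c \<subseteq> X"
    "\<And>s. range s \<subseteq> Worlds M \<Longrightarrow> fo_sat M s c \<longleftrightarrow> C s"
    using C unfolding definable_def by blast
  have "\<forall>\<phi>. \<exists>f. fo_consts f \<subseteq> Y \<and> fo_free f \<subseteq> X \<and> (\<forall>s. range s \<subseteq> Worlds M \<longrightarrow>
      (fo_sat M s f \<longleftrightarrow> sat (edited M s E) (map (term_val s) ts) \<phi>))"
    by (intro allI definable_sat[OF sym fin(1), unfolded definable_def])
  from choice[OF this] obtain f where "\<forall>\<phi>. fo_consts (f \<phi>) \<subseteq> Y \<and> fo_free (f \<phi>) \<subseteq> X \<and>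
      (\<forall>s. range s \<subseteq> Worlds M \<longrightarrow>
        (fo_sat M s (f \<phi>) \<longleftrightarrow> sat (edited M s E) (map (term_val s) ts) \<phi>))" ..
  then have f: "\<And>\<phi>. fo_consts (f \<phi>) \<subseteq> Y" "\<And>\<phi>. fo_free (f \<phi>) \<subseteq> X"
    "\<And>\<phi> s. range s \<subseteq> Worlds M \<Longrightarrow>
      fo_sat M s (f \<phi>) \<longleftrightarrow> sat (edited M s E) (map (term_val s) ts) \<phi>"
    by simp_all
  let ?\<Gamma> = "insert c (f ` \<Phi>)"
  have realizes: "realizes M \<Delta>" if \<Delta>: "finite \<Delta>" "\<Delta> \<subseteq> ?\<Gamma>" for \<Delta>
  proof -
    \<comment> \<open>\<open>c\<close> is set aside, since it need not be a translation; the
      valuation behind a member of \<open>?D\<close> satisfies it anyway.\<close>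
    have "finite (\<Delta> - {c})" "\<Delta> - {c} \<subseteq> f ` \<Phi>" using \<Delta> by auto
    then obtain F where F: "F \<subseteq> \<Phi>" "finite F" "\<Delta> - {c} = f ` F"
      by (meson finite_subset_image)
    then have "\<exists>P\<in>?D. \<forall>\<phi>\<in>F. models P \<phi>" using fs by simp
    then obtain P where "P \<in> ?D" "\<forall>\<phi>\<in>F. models P \<phi>" ..
    then obtain s where s: "range s \<subseteq> Worlds M" "C s"
      "\<forall>\<phi>\<in>F. sat (edited M s E) (map (term_val s) ts) \<phi>"
      unfolding models_def by auto
    have "\<forall>\<psi>\<in>\<Delta>. fo_sat M s \<psi>"
    proof
      fix \<psi> assume "\<psi> \<in> \<Delta>"
      then have "\<psi> = c \<or> \<psi> \<in> f ` F" using F(3) by blast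
      then show "fo_sat M s \<psi>" using s c(3) f(3) by auto
    qed
    then show ?thesis using s(1) unfolding realizes_def by blast
  qed
  have Y: "Y \<subseteq> Worlds M" using sym by (simp add: symbolic_def)
  have \<Gamma>: "\<forall>\<phi>\<in>?\<Gamma>. fo_consts \<phi> \<subseteq> Y \<and> fo_free \<phi> \<subseteq> X" using c(1,2) f(1,2) by simp
  have "\<forall>\<Delta>. finite \<Delta> \<and> \<Delta> \<subseteq> ?\<Gamma> \<longrightarrow> realizes M \<Delta>"
    by (intro allI impI, elim conjE) (rule realizes)
  with fin Y \<Gamma> have "realizes M ?\<Gamma>"
    by (intro sat[unfolded omega_saturated_def, THEN spec, THEN spec, THEN spec, THEN mp] conjI)
  then obtain s where "range s \<subseteq> Worlds M" "\<forall>\<phi>\<in>?\<Gamma>. fo_sat M s \<phi>"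
    unfolding realizes_def by blast
  then have "(edited M s E, map (term_val s) ts) \<in> ?D"
    "\<forall>\<phi>\<in>\<Phi>. models (edited M s E, map (term_val s) ts) \<phi>"
    using c(3) f(3) by (auto simp: models_def)
  then show "\<exists>P\<in>?D. \<forall>\<phi>\<in>\<Phi>. models P \<phi>" by blast
qed

lemma valuation_of_pair:
  assumes "a \<in> W" "b \<in> W"
  obtains s :: "nat \<Rightarrow> 'w" where "range s \<subseteq> W" "s 0 = a" "s 1 = b"
  \<comment> \<open>All other variables take the value \<open>b\<close> as well, which keeps the
    whole range inside \<open>W\<close>.\<close>
  using assms that[of "\<lambda>n. if n = 0 then a else b"] by auto

text \<open>Each successor set is a definable family: variable 0 names the learner's new world, and
  variables 0 and 1 name the endpoints of an edited edge.\<close>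

lemma modally_compact_successors:
  assumes sat: "omega_saturated M" and rep: "represented M (N, T)"
  shows "modally_compact {(N, T @ [v]) | v. (last T, v) \<in> Rel1 N}" (is "modally_compact ?DL")
    and "modally_compact ((\<lambda>l. (delete N l, T)) ` ((Rel1 N - Rel2 N) - links T))"
      (is "modally_compact ?DM")
    and "modally_compact ((\<lambda>l. (add N l, T)) ` (Rel2 N - Rel1 N))" (is "modally_compact ?DP")
proof -
  obtain Y E ts where *: "finite Y" "symbolic M Y {} E ts"
    "\<And>s. edited M s E = N" "\<And>s. map (term_val s) ts = T"
    using rep by (auto simp: represented_def)
  let ?X = "{0, 1} :: nat set" and ?x = "Var 0" and ?y = "Var 1"
  have Y: "Y \<subseteq> Worlds M" using *(2) by (simp add: symbolic_def)
  have sym: "symbolic M Y ?X E ts" by (rule symbolic_mono[OF *(2) _ Y]) auto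
  have ov: "term_over Y ?X ?x" "term_over Y ?X ?y" by (simp_all add: term_over_def)
  have X: "finite ?X" by simp
  note bounds = represented_bounds[OF rep]
  have R2: "Rel2 N = Rel2 M" using Rel2_edited[of M _ E] *(3) by metis
  note lastT = last_path[OF *(2), unfolded *(4), symmetric]
  have "definable M Y ?X (\<lambda>s. (term_val s (last ts), term_val s ?x) \<in> Rel1 (edited M s E))"
    by (rule definable_Rel1_edited[OF sym symbolic_last[OF sym] ov(1)])
  then have "definable M Y ?X (\<lambda>s. (last T, s (0::nat)) \<in> Rel1 N)"
    by (simp add: *(3) lastT)
  from modally_compact_definable[OF sat symbolic_snoc[OF sym ov(1)] X *(1) this]
  have "modally_compact {(N, T @ [s (0::nat)]) | s. range s \<subseteq> Worlds M \<and> (last T, s (0::nat)) \<in> Rel1 N}"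
    by (simp add: *(3,4))
  \<comment> \<open>Every actual successor comes from a valuation because \<open>Rel1 N\<close>
    stays within \<open>Worlds M\<close>.\<close>
  moreover have "{(N, T @ [s (0::nat)]) | s. range s \<subseteq> Worlds M \<and> (last T, s (0::nat)) \<in> Rel1 N} = ?DL"
    using bounds(1) by (auto; metis (no_types, lifting) SigmaD2 subsetD valuation_of_pair)
  ultimately show "modally_compact ?DL" by simp
  have "definable M Y ?X (\<lambda>s. ((term_val s ?x, term_val s ?y) \<in> Rel1 (edited M s E) \<and>
      \<not> (term_val s ?x, term_val s ?y) \<in> Rel2 M) \<and>
      \<not> (term_val s ?x, term_val s ?y) \<in> links (map (term_val s) ts))"
    by (intro definable_and definable_not definable_Rel1_edited[OF sym] definable_Rel2
        definable_links[OF sym] ov)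
  then have "definable M Y ?X (\<lambda>s. (s (0::nat), s (1::nat)) \<in> (Rel1 N - Rel2 N) - links T)"
    by (simp add: * R2)
  from modally_compact_definable[OF sat symbolic_edit[OF sym ov] X *(1) this, of False]
  have "modally_compact {(delete N (s (0::nat), s (1::nat)), T) | s. range s \<subseteq> Worlds M \<and>
      (s (0::nat), s (1::nat)) \<in> (Rel1 N - Rel2 N) - links T}"
    by (simp add: *(3,4))
  moreover have "{(delete N (s (0::nat), s (1::nat)), T) | s. range s \<subseteq> Worlds M \<and>
      (s (0::nat), s (1::nat)) \<in> (Rel1 N - Rel2 N) - links T} = ?DM" (is "?A = _")
  proof
    show "?DM \<subseteq> ?A"
    proof clarify
      fix a b assume ab: "(a, b) \<in> Rel1 N" "(a, b) \<notin> Rel2 N" "(a, b) \<notin> links T"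
      then obtain s :: "nat \<Rightarrow> 'a" where "range s \<subseteq> Worlds M" "s (0::nat) = a" "s (1::nat) = b"
        using bounds(1) valuation_of_pair[of a "Worlds M" b] by blast
      with ab show "\<exists>s. (delete N (a, b), T) = (delete N (s (0::nat), s (1::nat)), T) \<and> range s \<subseteq> Worlds M \<and>
          (s (0::nat), s (1::nat)) \<in> (Rel1 N - Rel2 N) - links T" by blast
    qed
  qed auto
  ultimately show "modally_compact ?DM" by simp
  have "definable M Y ?X (\<lambda>s. (term_val s ?x, term_val s ?y) \<in> Rel2 M \<and>
      \<not> (term_val s ?x, term_val s ?y) \<in> Rel1 (edited M s E))"
    by (intro definable_and definable_not definable_Rel1_edited[OF sym] definable_Rel2 ov)
  then have "definable M Y ?X (\<lambda>s. (s (0::nat), s (1::nat)) \<in> Rel2 N - Rel1 N)"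
    by (simp add: * R2)
  from modally_compact_definable[OF sat symbolic_edit[OF sym ov] X *(1) this, of True]
  have "modally_compact {(add N (s (0::nat), s (1::nat)), T) | s. range s \<subseteq> Worlds M \<and>
      (s (0::nat), s (1::nat)) \<in> Rel2 N - Rel1 N}"
    by (simp add: *(3,4))
  moreover have "{(add N (s (0::nat), s (1::nat)), T) | s. range s \<subseteq> Worlds M \<and>
      (s (0::nat), s (1::nat)) \<in> Rel2 N - Rel1 N} = ?DP" (is "?A = _")
  proof
    show "?DP \<subseteq> ?A"
    proof clarify
      fix a b assume ab: "(a, b) \<in> Rel2 N" "(a, b) \<notin> Rel1 N"
      then obtain s :: "nat \<Rightarrow> 'a" where "range s \<subseteq> Worlds M" "s (0::nat) = a" "s (1::nat) = b"
        using bounds(2) valuation_of_pair[of a "Worlds M" b] by blast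
      with ab show "\<exists>s. (add N (a, b), T) = (add N (s (0::nat), s (1::nat)), T) \<and> range s \<subseteq> Worlds M \<and>
          (s (0::nat), s (1::nat)) \<in> Rel2 N - Rel1 N" by blast
    qed
  qed auto
  ultimately show "modally_compact ?DP" by simp
qed

text \<open>Only finitely many successors arise by deleting a path link, so
  \<open>modally_compact_finite\<close> applies to them.\<close>

lemma finite_links: "finite (links S)"
proof -
  have "links S \<subseteq> set S \<times> set S" by (fastforce simp: links_def)
  then show ?thesis by (rule finite_subset) simp
qed


section \<open>The Hennessy--Milner argument\<close>

section \<open>Modal equivalence as a bisimulation\<close>

text \<open>The language has no truth constant, so the empty conjunction is a tautology in an
  arbitrary atom.\<close>

primrec conj_list :: "'p form list \<Rightarrow> 'p form" where
  "conj_list [] = Neg (And (Atom undefined) (Neg (Atom undefined)))"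
| "conj_list (\<phi> # \<phi>s) = And \<phi> (conj_list \<phi>s)"

lemma models_conj_list: "models P (conj_list \<phi>s) \<longleftrightarrow> (\<forall>\<phi>\<in>set \<phi>s. models P \<phi>)"
  by (induction \<phi>s) (auto simp: models_def)

text \<open>Finite parts of the theory of \<open>P\<close> are single formulas, their conjunctions,
  and \<open>transfer\<close> carries these to \<open>D'\<close>. Compactness then realizes the
  whole theory in one member.\<close>

lemma equivalent_successor:
  fixes D :: "('w, 'p) pointed set" and D' :: "('v, 'p) pointed set"
  assumes "modally_compact D'" "P \<in> D"
    and transfer: "\<And>\<phi>. \<exists>P\<in>D. models P \<phi> \<Longrightarrow> \<exists>P'\<in>D'. models P' \<phi>"
  shows "\<exists>P'\<in>D'. \<forall>\<phi>. models P \<phi> \<longleftrightarrow> models P' \<phi>"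
proof -
  have fin: "\<exists>P'\<in>D'. \<forall>\<phi>\<in>F. models P' \<phi>" if "finite F" "F \<subseteq> {\<phi>. models P \<phi>}" for F
  proof -
    obtain \<phi>s where \<phi>s: "set \<phi>s = F" using finite_list[OF \<open>finite F\<close>] by blast
    then have "models P (conj_list \<phi>s)" using that(2) by (auto simp: models_conj_list)
    with assms(2) have "\<exists>P\<in>D. models P (conj_list \<phi>s)" ..
    from transfer[OF this] show ?thesis by (simp add: models_conj_list \<phi>s)
  qed
  have "\<exists>P'\<in>D'. \<forall>\<phi>\<in>{\<phi>. models P \<phi>}. models P' \<phi>"
    using assms(1) by (rule modally_compactD) (rule fin)
  then obtain P' where P': "P' \<in> D'" "\<forall>\<phi>. models P \<phi> \<longrightarrow> models P' \<phi>" by auto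
  \<comment> \<open>A formula false at \<open>P\<close> has its negation in the theory of
    \<open>P\<close>, so inclusion of theories is already equality.\<close>
  moreover have "models P \<phi>" if "models P' \<phi>" for \<phi>
    using P'(2)[rule_format, of "Neg \<phi>"] that by (auto simp: models_def)
  ultimately show ?thesis by blast
qed

text \<open>The restriction to reachable pointed models gives the required range and makes the
  points representable, hence their successor sets compact.\<close>

definition equivalence_relation ::
    "('w, 'p) pointed \<Rightarrow> ('v, 'p) pointed \<Rightarrow> (('w, 'p) pointed \<times> ('v, 'p) pointed) set" where
  "equivalence_relation P P' = {(Q, Q'). Q \<in> reachable P \<and> Q' \<in> reachable P' \<and>
     (\<forall>\<phi>. models Q \<phi> \<longleftrightarrow> models Q' \<phi>)}"

text \<open>Reduces the Zag clauses to Zig clauses with the two sides exchanged.\<close>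

lemma converse_equivalence_relation:
  "(equivalence_relation P P')\<inverse> = equivalence_relation P' P"
  by (auto simp: equivalence_relation_def)

lemma reachable_step: "Q \<in> reachable P \<Longrightarrow> (Q, R) \<in> U \<union> learner \<Longrightarrow> R \<in> reachable P"
  unfolding reachable_def by (auto intro: rtrancl_into_rtrancl)

text \<open>A Zig clause seeks the matching successor on the primed side, so the assumptions concern
  that side: they make its successor sets compact.\<close>

lemma zig_equivalence_relation:
  assumes pm: "pointed_model M' S'" and sat: "omega_saturated M'"
  shows "zig_L (equivalence_relation P (M', S'))" (is "zig_L ?Z")
    and "zig_minus1 (equivalence_relation P (M', S'))"
    and "zig_minus2 (equivalence_relation P (M', S'))"
    and "zig_plus (equivalence_relation P (M', S'))"
proof -
  \<comment> \<open>All four clauses are instances: \<open>D\<close> and \<open>D'\<close> are the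
    successor sets belonging to the modality \<open>dia\<close>.\<close>
  have succ: "\<exists>Q'\<in>D'. (Q, Q') \<in> ?Z"
    if "((N, T), (N', T')) \<in> ?Z" "modally_compact D'" "Q \<in> D"
      and "\<And>Q. Q \<in> D \<Longrightarrow> ((N, T), Q) \<in> U \<union> learner"
      and "\<And>Q'. Q' \<in> D' \<Longrightarrow> ((N', T'), Q') \<in> U \<union> learner"
      and dia: "\<And>\<phi>. models (N, T) (dia \<phi>) \<longleftrightarrow> (\<exists>Q\<in>D. models Q \<phi>)"
        "\<And>\<phi>. models (N', T') (dia \<phi>) \<longleftrightarrow> (\<exists>Q'\<in>D'. models Q' \<phi>)"
    for N T N' T' D D' Q dia
  proof -
    \<comment> \<open>The modality turns existence of a successor satisfying \<phi> into a formula
      at the current point, where both sides agree.\<close>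
    have "\<exists>Q'\<in>D'. models Q' \<phi>" if "\<exists>Q\<in>D. models Q \<phi>" for \<phi>
      using that \<open>((N, T), (N', T')) \<in> ?Z\<close> unfolding dia[symmetric]
      by (simp add: equivalence_relation_def)
    from equivalent_successor[OF that(2,3) this]
    obtain Q' where Q': "Q' \<in> D'" "\<forall>\<phi>. models Q \<phi> \<longleftrightarrow> models Q' \<phi>" by blast
    have "Q \<in> reachable P" "Q' \<in> reachable (M', S')"
      using that(1) reachable_step[OF _ that(4)[OF that(3)]] reachable_step[OF _ that(5)[OF Q'(1)]]
      by (simp_all add: equivalence_relation_def)
    then show ?thesis
      using Q' by (auto simp: equivalence_relation_def)
  qed
  have compact: "modally_compact {(N', T' @ [v]) | v. (last T', v) \<in> Rel1 N'}"
    "modally_compact ((\<lambda>l. (delete N' l, T')) ` ((Rel1 N' - Rel2 N') - links T'))"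
    "modally_compact ((\<lambda>l. (add N' l, T')) ` (Rel2 N' - Rel1 N'))"
    if "((N, T), (N', T')) \<in> ?Z" for N T N' T'
    by (rule modally_compact_successors[OF sat represented_reachable[OF pm]],
        use that in \<open>simp add: equivalence_relation_def\<close>)+
  show "zig_L ?Z"
    unfolding zig_L_def
  proof (intro allI impI)
    fix N T N' T' v
    assume Z: "((N, T), (N', T')) \<in> ?Z" and v: "(last T, v) \<in> Rel1 N"
    have "\<exists>Q'\<in>{(N', T' @ [v]) | v. (last T', v) \<in> Rel1 N'}. ((N, T @ [v]), Q') \<in> ?Z"
      by (rule succ[OF Z compact(1)[OF Z],
            of _ "{(N, T @ [v]) | v. (last T, v) \<in> Rel1 N}" DiaL])
         (use v in \<open>auto simp: models_def intro: learner.intros\<close>)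
    then show "\<exists>v'. (last T', v') \<in> Rel1 N' \<and> ((N, T @ [v]), (N', T' @ [v'])) \<in> ?Z" by blast
  qed
  show "zig_minus1 ?Z"
    unfolding zig_minus1_def
  proof (intro allI impI ballI)
    fix N T N' T' l
    assume Z: "((N, T), (N', T')) \<in> ?Z" and l: "l \<in> links T - Rel2 N"
    have "\<exists>Q'\<in>(\<lambda>l. (delete N' l, cut T' l)) ` (links T' - Rel2 N').
        ((delete N l, cut T l), Q') \<in> ?Z"
      by (rule succ[OF Z modally_compact_finite,
            of _ _ "(\<lambda>l. (delete N l, cut T l)) ` (links T - Rel2 N)" DiaMinus1])
         (use l in \<open>auto simp: models_def finite_links intro: U.intros\<close>)
    then show "\<exists>l'\<in>links T' - Rel2 N'. ((delete N l, cut T l), (delete N' l', cut T' l')) \<in> ?Z"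
      by blast
  qed
  show "zig_minus2 ?Z"
    unfolding zig_minus2_def
  proof (intro allI impI ballI)
    fix N T N' T' l
    assume Z: "((N, T), (N', T')) \<in> ?Z" and l: "l \<in> (Rel1 N - Rel2 N) - links T"
    have "\<exists>Q'\<in>(\<lambda>l. (delete N' l, T')) ` ((Rel1 N' - Rel2 N') - links T').
        ((delete N l, T), Q') \<in> ?Z"
      by (rule succ[OF Z compact(2)[OF Z],
            of _ "(\<lambda>l. (delete N l, T)) ` ((Rel1 N - Rel2 N) - links T)" DiaMinus2])
         (use l in \<open>auto simp: models_def intro: U.intros\<close>)
    then show "\<exists>l'\<in>(Rel1 N' - Rel2 N') - links T'. ((delete N l, T), (delete N' l', T')) \<in> ?Z"
      by blast
  qed
  show "zig_plus ?Z"
    unfolding zig_plus_def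
  proof (intro allI impI ballI)
    fix N T N' T' l
    assume Z: "((N, T), (N', T')) \<in> ?Z" and l: "l \<in> Rel2 N - Rel1 N"
    have "\<exists>Q'\<in>(\<lambda>l. (add N' l, T')) ` (Rel2 N' - Rel1 N'). ((add N l, T), Q') \<in> ?Z"
      by (rule succ[OF Z compact(3)[OF Z],
            of _ "(\<lambda>l. (add N l, T)) ` (Rel2 N - Rel1 N)" DiaPlus])
         (use l in \<open>auto simp: models_def intro: U.intros\<close>)
    then show "\<exists>l'\<in>Rel2 N' - Rel1 N'. ((add N l, T), (add N' l', T')) \<in> ?Z" by blast
  qed
qed

theorem theorem3:
  fixes M :: "('w, 'p::countable) model" and S :: "'w list"
    and M' :: "('v, 'p) model" and S' :: "'v list"
  assumes "pointed_model M S" and "pointed_model M' S'"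
    and "omega_saturated M" and "omega_saturated M'"
    and "learning_modal_equivalent M S M' S'"
  shows "\<exists>Z. l_bisimulation Z (M, S) (M', S')"
proof
  let ?Z = "equivalence_relation (M, S) (M', S')"
  have base: "((M, S), (M', S')) \<in> ?Z"
    using assms(5)
    by (simp add: equivalence_relation_def reachable_def learning_modal_equivalent_def models_def)
  moreover have "?Z \<subseteq> reachable (M, S) \<times> reachable (M', S')"
    by (auto simp: equivalence_relation_def)
  moreover have "atom_harmony ?Z"
    by (auto simp only: atom_harmony_def equivalence_relation_def models_def split_conv
        mem_Collect_eq fst_conv snd_conv)
  \<comment> \<open>The first instance gives the Zig clauses from saturation of \<open>M'\<close>;
    the second, for the converse relation, gives the Zag clauses from saturation of
    \<open>M\<close>.\<close>
  ultimately show "l_bisimulation ?Z (M, S) (M', S')"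
    using zig_equivalence_relation[OF assms(2,4), of "(M, S)"]
      zig_equivalence_relation[OF assms(1,3), of "(M', S')"]
    unfolding l_bisimulation_def converse_equivalence_relation by auto
qed

end
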